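(* Let $V$ be a finite set of at least $4$ points on a $2$-sphere in $\mathbb{R}^3$. Then the number $N'(V)$ of strict double-normal pairs in $V$ (as a subset of $\mathbb{R}^3$) satisfies \[N'(V)\leq 2|V|-2 .\] This bound is sharp for each $|V|\geq 4$; that is, for every integer $n\geq 4$ there exists a set $V$ of $n$ points on a $2$-sphere in $\mathbb{R}^3$ with $N'(V)=2n-2$.
   Context: For a finite set $V$ of points in $\mathbb{R}^3$, a strict double-normal pair of $V$ is an (unordered) pair $\{p,q\}$ of distinct points of $V$ such that $V\setminus\{p,q\}$ lies in the open strip bounded by the planes through $p$ and $q$, respectively, that are perpendicular to the segment $pq$. $N'(V)$ denotes the number of strict double-normal pairs of $V$. A $2$-sphere in $\mathbb{R}^3$ is an ordinary round Euclidean sphere. *)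

theory Defs
  imports "HOL-Analysis.Analysis"
begin

(* The planes through p and q perpendicular to the segment pq are
   (q - p) \<bullet> (x - p) = 0 and (q - p) \<bullet> (x - q) = 0. *)
definition open_strip :: "'a::real_inner \<Rightarrow> 'a \<Rightarrow> 'a set" where
  "open_strip p q = {x. 0 < (q - p) \<bullet> (x - p) \<and> (q - p) \<bullet> (x - q) < 0}"

lemma open_strip_commute: "open_strip p q = open_strip q p"
proof -
  have "(p - q) \<bullet> y = - ((q - p) \<bullet> y)" for y
    by (simp add: inner_diff_left)
  then show ?thesis
    by (auto simp: open_strip_def)
qed

definition strict_double_normal :: "'a::real_inner set \<Rightarrow> 'a \<Rightarrow> 'a \<Rightarrow> bool" where
  "strict_double_normal V p q \<longleftrightarrow>
     p \<in> V \<and> q \<in> V \<and> p \<noteq> q \<and> V - {p, q} \<subseteq> open_strip p q"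

lemma strict_double_normal_commute:
  "strict_double_normal V p q \<longleftrightarrow> strict_double_normal V q p"
  by (auto simp: strict_double_normal_def open_strip_commute[of q p] insert_commute)

definition strict_double_normal_pairs :: "'a::real_inner set \<Rightarrow> 'a set set" where
  "strict_double_normal_pairs V = {{p, q} | p q. strict_double_normal V p q}"

definition num_strict_double_normals :: "'a::real_inner set \<Rightarrow> nat" where
  "num_strict_double_normals V = card (strict_double_normal_pairs V)"

end

theory Submission
  imports Defs
begin

text \<open>
  Let \<open>x \<mapsto> 2c - x\<close> be the antipodal map of the sphere and let \<open>W\<close> be the union of \<open>V\<close> with its antipodal
  image \<open>V'\<close>.  A pair \<open>{p, q}\<close> of \<open>V\<close> is a strict double-normal pair iff the segment from \<open>p\<close> to the
  antipode of \<open>q\<close> is an edge of the convex hull of \<open>W\<close>, so each pair yields two edges between \<open>V\<close> and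
  \<open>V'\<close>.  (If \<open>V\<close> contains two antipodal points, they form a pair with each other and no pair with
  any other point, and can be discarded.)  It remains to see that the edge graph of a polytope with
  \<open>N = 2n\<close> vertices on a sphere has at most \<open>2N - 4\<close> edges between two colour classes.

  Euler's formula is replaced by a count of middle vertices.  Fix a generic linear functional.  A facet
  \<open>F\<close> has \<open>|F| - 2\<close> vertices that are neither its highest nor its lowest; a vertex \<open>y\<close> of \<open>W\<close> is in
  this position in at most two facets, because these facets meet the horizontal plane through \<open>y\<close> in
  edges at \<open>y\<close> of a convex polygon, and in none if \<open>y\<close> is the top or the bottom of \<open>W\<close>.  Hence the sum
  of \<open>|F| - 2\<close> over all facets is at most \<open>2(N - 2)\<close>.  A facet contains at most \<open>2(|F| - 2)\<close>
  bichromatic edges, and each edge lies in two facets.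

  Equality is attained by \<open>n - 2\<close> points on an arc of a great circle together with two points that are
  nearly the poles of that circle.
\<close>

section \<open>Planar convexity and generic directions\<close>

lemma card_le_2I:
  assumes "\<And>a b c. a \<in> S \<Longrightarrow> b \<in> S \<Longrightarrow> c \<in> S \<Longrightarrow> a \<noteq> b \<Longrightarrow> a \<noteq> c \<Longrightarrow> b \<noteq> c \<Longrightarrow> False"
  shows "card S \<le> 2"
proof (rule ccontr)
  assume "\<not> card S \<le> 2"
  then have "3 \<le> card S" by simp
  then obtain T where "T \<subseteq> S" "card T = 3"
    by (meson obtain_subset_with_card_n)
  then show False
    using assms unfolding card_3_iff by blast
qed

text \<open>A convex polygon has at most two edges at a vertex. The three directions lie in the
  plane orthogonal to \<open>u\<close>, so they are linearly dependent. Pairing the dependency with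
  \<open>a1\<close>, \<open>a2\<close>, \<open>a3\<close> shows that any two of its coefficients
  have opposite signs or both vanish. Three reals can satisfy this only if all are zero.\<close>

lemma three_directions_in_plane:
  fixes u :: "real^3"
  assumes u: "u \<noteq> 0" "u \<bullet> d1 = 0" "u \<bullet> d2 = 0" "u \<bullet> d3 = 0"
    and a1: "a1 \<bullet> d1 = 0" "0 < a1 \<bullet> d2" "0 < a1 \<bullet> d3"
    and a2: "a2 \<bullet> d2 = 0" "0 < a2 \<bullet> d1" "0 < a2 \<bullet> d3"
    and a3: "a3 \<bullet> d3 = 0" "0 < a3 \<bullet> d1" "0 < a3 \<bullet> d2"
  shows False
proof -
  have distinct: "d1 \<noteq> d2" "d1 \<noteq> d3" "d2 \<noteq> d3"
    using a1 a2 by auto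
  have "{d1, d2, d3} \<subseteq> {x. u \<bullet> x = 0}"
    using u by auto
  moreover have "dim {x. u \<bullet> x = 0} = 2"
    using dim_hyperplane[OF u(1)] by simp
  ultimately have "dependent {d1, d2, d3}"
    using independent_card_le_dim[of "{d1, d2, d3}" "{x. u \<bullet> x = 0}"] distinct by auto
  then obtain c where c: "\<exists>v\<in>{d1, d2, d3}. c v \<noteq> 0" "(\<Sum>v\<in>{d1, d2, d3}. c v *\<^sub>R v) = 0"
    using dependent_finite[of "{d1, d2, d3}"] by auto
  have eq: "c d1 *\<^sub>R d1 + c d2 *\<^sub>R d2 + c d3 *\<^sub>R d3 = 0"
    using c(2) distinct by (simp add: add.assoc)
  have e: "c d1 * (a \<bullet> d1) + c d2 * (a \<bullet> d2) + c d3 * (a \<bullet> d3) = 0" for a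
    using arg_cong[OF eq, of "\<lambda>x. a \<bullet> x"] by (simp add: inner_add_right)
  have opposite: "s * t \<le> 0 \<and> (s = 0 \<longleftrightarrow> t = 0)" if "s * p + t * q = 0" "p > 0" "q > 0"
    for s t p q :: real
  proof -
    define k where "k = q / p"
    have "0 < k" and k: "q = k * p"
      using that by (simp_all add: k_def)
    then have "(s + t * k) * p = 0"
      using that(1) by (simp add: algebra_simps)
    then have s: "s = - (t * k)"
      using that(2) by simp
    have "s * t = - (k * (t * t))"
      by (simp add: s)
    moreover have "0 \<le> k * (t * t)"
      using \<open>0 < k\<close> by simp
    ultimately have "s * t \<le> 0"
      by linarith
    moreover have "s = 0 \<longleftrightarrow> t = 0"
      using s \<open>0 < k\<close> by simp
    ultimately show ?thesis
      by blast
  qed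
  have "c d2 * c d3 \<le> 0 \<and> (c d2 = 0 \<longleftrightarrow> c d3 = 0)"
    using opposite[of "c d2" _ "c d3"] e[of a1] a1 by auto
  moreover have "c d1 * c d3 \<le> 0 \<and> (c d1 = 0 \<longleftrightarrow> c d3 = 0)"
    using opposite[of "c d1" _ "c d3"] e[of a2] a2 by auto
  moreover have "c d1 * c d2 \<le> 0 \<and> (c d1 = 0 \<longleftrightarrow> c d2 = 0)"
    using opposite[of "c d1" _ "c d2"] e[of a3] a3 by auto
  ultimately have "c d1 = 0" "c d2 = 0" "c d3 = 0"
    by (auto simp: mult_le_0_iff)
  then show False
    using c(1) by auto
qed

text \<open>Each pair of distinct points excludes only a hyperplane of directions, and finitely many
  hyperplanes form a negligible set.\<close>

lemma exists_injective_direction: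
  fixes W :: "'a::euclidean_space set"
  assumes "finite W"
  obtains u where "inj_on ((\<bullet>) u) W" "u \<noteq> 0"
proof -
  \<comment> \<open>Inserting \<open>0\<close> secures \<open>u \<noteq> 0\<close> even when
    \<open>W\<close> has fewer than two points.\<close>
  define D where "D = insert 0 (\<Union>(x, y)\<in>{(x, y) \<in> W \<times> W. x \<noteq> y}. {u. (x - y) \<bullet> u = 0})"
  have "finite {(x, y) \<in> W \<times> W. x \<noteq> y}"
    by (rule finite_subset[of _ "W \<times> W"]) (use assms in auto)
  then have "negligible D"
    unfolding D_def negligible_insert
    by (intro negligible_Union) (auto intro!: negligible_hyperplane)
  then obtain u where u: "u \<notin> D"
    by (metis UNIV_eq_I non_negligible_UNIV)
  have "inj_on ((\<bullet>) u) W"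
  proof (rule inj_onI, rule ccontr)
    fix x y assume "x \<in> W" "y \<in> W" "u \<bullet> x = u \<bullet> y" "x \<noteq> y"
    then show False
      using u by (auto simp: D_def inner_diff_left inner_commute[of u])
  qed
  moreover have "u \<noteq> 0"
    using u by (auto simp: D_def)
  ultimately show ?thesis
    using that by blast
qed

section \<open>Edges and facets of a finite point set\<close>

text \<open>An edge of the convex hull of \<open>W\<close>, encoded by a linear functional whose
  minimum over \<open>W\<close> is attained exactly at its two endpoints.\<close>

definition exposed_edge :: "'a::real_inner set \<Rightarrow> 'a \<Rightarrow> 'a \<Rightarrow> bool" where
  "exposed_edge W x y \<longleftrightarrow> x \<in> W \<and> y \<in> W \<and> x \<noteq> y \<and>
     (\<exists>a. a \<bullet> (y - x) = 0 \<and> (\<forall>w\<in>W - {x, y}. 0 < a \<bullet> (w - x)))"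

lemma exposed_edge_commute: "exposed_edge W x y \<longleftrightarrow> exposed_edge W y x"
proof -
  have "exposed_edge W y x" if "exposed_edge W x y" for x y
  proof -
    obtain a where "a \<bullet> (y - x) = 0" "\<forall>w\<in>W - {x, y}. 0 < a \<bullet> (w - x)"
      using \<open>exposed_edge W x y\<close> by (auto simp: exposed_edge_def)
    then show ?thesis
      using that unfolding exposed_edge_def
      by (intro conjI exI[of _ a]) (auto simp: inner_diff_right)
  qed
  then show ?thesis by blast
qed

text \<open>A facet is represented by the points of \<open>W\<close> on it. On a sphere three points
  are never collinear, so \<open>3 \<le> card F\<close> makes \<open>F\<close> span its plane. If
  \<open>W\<close> is coplanar, \<open>W\<close> itself may count as a facet.\<close>

definition facet :: "'a::real_inner set \<Rightarrow> 'a set \<Rightarrow> bool" where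
  "facet W F \<longleftrightarrow> 3 \<le> card F \<and>
     (\<exists>a b. a \<noteq> 0 \<and> (\<forall>w\<in>W. b \<le> a \<bullet> w) \<and> F = {w \<in> W. a \<bullet> w = b})"

text \<open>The functionals exposing three edges at \<open>x\<close> inside one plane would form the
  configuration excluded by \<open>three_directions_in_plane\<close>.\<close>

lemma exposed_degree_in_plane:
  fixes a :: "real^3"
  assumes "a \<noteq> 0" and "\<And>w. w \<in> F \<Longrightarrow> a \<bullet> w = b" and "F \<subseteq> W" and "x \<in> F"
  shows "card {y \<in> F. exposed_edge W x y} \<le> 2"
proof (rule card_le_2I)
  fix y1 y2 y3
  assume y: "y1 \<in> {y \<in> F. exposed_edge W x y}" "y2 \<in> {y \<in> F. exposed_edge W x y}"
    "y3 \<in> {y \<in> F. exposed_edge W x y}" and d: "y1 \<noteq> y2" "y1 \<noteq> y3" "y2 \<noteq> y3"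
  have *: "\<exists>e. e \<bullet> (y - x) = 0 \<and> (\<forall>w\<in>W - {x, y}. 0 < e \<bullet> (w - x))"
    if "y \<in> {y \<in> F. exposed_edge W x y}" for y
    using that by (auto simp: exposed_edge_def)
  obtain e1 where e1: "e1 \<bullet> (y1 - x) = 0" "\<forall>w\<in>W - {x, y1}. 0 < e1 \<bullet> (w - x)"
    using *[OF y(1)] by blast
  obtain e2 where e2: "e2 \<bullet> (y2 - x) = 0" "\<forall>w\<in>W - {x, y2}. 0 < e2 \<bullet> (w - x)"
    using *[OF y(2)] by blast
  obtain e3 where e3: "e3 \<bullet> (y3 - x) = 0" "\<forall>w\<in>W - {x, y3}. 0 < e3 \<bullet> (w - x)"
    using *[OF y(3)] by blast
  have "y1 \<in> W - {x}" "y2 \<in> W - {x}" "y3 \<in> W - {x}"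
    using y by (auto simp: exposed_edge_def)
  moreover have "a \<bullet> (y1 - x) = 0" "a \<bullet> (y2 - x) = 0" "a \<bullet> (y3 - x) = 0"
    using assms y by (auto simp: inner_diff_right)
  ultimately show False
    using three_directions_in_plane[OF \<open>a \<noteq> 0\<close>, of "y1 - x" "y2 - x" "y3 - x" e1 e2 e3]
      e1 e2 e3 d by auto
qed

text \<open>A line meets a sphere in at most two points.\<close>

lemma cross3_nonzero_sphere:
  fixes x y z c :: "real^3"
  assumes "x \<in> sphere c r" "y \<in> sphere c r" "z \<in> sphere c r" "x \<noteq> y" "x \<noteq> z" "y \<noteq> z"
  shows "cross3 (y - x) (z - x) \<noteq> 0"
proof
  assume "cross3 (y - x) (z - x) = 0"
  then have "collinear {0, y - x, z - x}"
    by (simp add: cross_eq_0)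
  then obtain t where t: "z - x = t *\<^sub>R (y - x)"
    using assms by (auto simp: collinear_lemma)
  define d where "d = y - x"
  define e where "e = x - c"
  have y: "y = c + (e + d)" and z: "z = c + (e + t *\<^sub>R d)" and x: "x = c + e"
    using t by (auto simp: d_def e_def algebra_simps)
  have "dist x c = r" "dist y c = r" "dist z c = r"
    using assms by (simp_all add: dist_commute)
  then have n: "norm e = r" "norm (e + d) = r" "norm (e + t *\<^sub>R d) = r"
    unfolding x y z by (simp_all add: dist_norm)
  have "(e + d) \<bullet> (e + d) = e \<bullet> e" "(e + t *\<^sub>R d) \<bullet> (e + t *\<^sub>R d) = e \<bullet> e"
    using n by (simp_all add: dot_square_norm)
  then have 1: "2 * (e \<bullet> d) + d \<bullet> d = 0" and 2: "2 * t * (e \<bullet> d) + t^2 * (d \<bullet> d) = 0"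
    by (simp_all add: inner_add_left inner_add_right inner_commute algebra_simps power2_eq_square)
  \<comment> \<open>Combining the two sphere equations eliminates \<open>e \<bullet> d\<close>,
    leaving only the parameters \<open>0\<close> and \<open>1\<close> of \<open>x\<close> and
    \<open>y\<close>.\<close>
  have "t * (t - 1) * (d \<bullet> d) = 2 * t * (e \<bullet> d) + t^2 * (d \<bullet> d) - t * (2 * (e \<bullet> d) + d \<bullet> d)"
    by (simp add: algebra_simps power2_eq_square)
  also have "\<dots> = 0"
    using 1 2 by simp
  finally have "t = 0 \<or> t = 1 \<or> d = 0"
    by auto
  then show False
    using assms t by (auto simp: d_def)
qed

lemma orthogonal_pair_parallel:
  fixes a :: "real^3"
  assumes "cross3 p q \<noteq> 0" "a \<bullet> p = 0" "a \<bullet> q = 0" "a \<noteq> 0"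
  obtains t where "t \<noteq> 0" "a = t *\<^sub>R cross3 p q"
proof -
  have "cross3 a (cross3 p q) = 0"
    using assms(2,3) by (simp add: Lagrange inner_commute)
  then have "collinear {0, cross3 p q, a}"
    by (simp add: cross_eq_0 insert_commute)
  then obtain t where "a = t *\<^sub>R cross3 p q"
    using assms by (auto simp: collinear_lemma)
  then show ?thesis
    using that assms by fastforce
qed

text \<open>Both normals are nonzero multiples of the same nonzero cross product.\<close>

lemma planes_through_three_points_eq:
  fixes W :: "(real^3) set"
  assumes W: "W \<subseteq> sphere c r"
    and xyz: "x \<in> W" "y \<in> W" "z \<in> W" "x \<noteq> y" "x \<noteq> z" "y \<noteq> z"
    and a: "a \<noteq> 0" "a \<bullet> x = b" "a \<bullet> y = b" "a \<bullet> z = b"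
    and a': "a' \<noteq> 0" "a' \<bullet> x = b'" "a' \<bullet> y = b'" "a' \<bullet> z = b'"
  shows "{w \<in> W. a \<bullet> w = b} = {w \<in> W. a' \<bullet> w = b'}"
proof -
  let ?n = "cross3 (y - x) (z - x)"
  have n: "?n \<noteq> 0"
    using cross3_nonzero_sphere[of x c r y z] W xyz by blast
  have "a \<bullet> (y - x) = 0" "a \<bullet> (z - x) = 0"
    using a by (simp_all add: inner_diff_right)
  from orthogonal_pair_parallel[OF n this a(1)] obtain s where "s \<noteq> 0" "a = s *\<^sub>R ?n" .
  moreover have "a' \<bullet> (y - x) = 0" "a' \<bullet> (z - x) = 0"
    using a' by (simp_all add: inner_diff_right)
  from orthogonal_pair_parallel[OF n this a'(1)] obtain t where "t \<noteq> 0" "a' = t *\<^sub>R ?n" .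
  ultimately show ?thesis
    using a(2) a'(2) by auto
qed

text \<open>Each such facet meets the plane through \<open>y\<close> orthogonal to \<open>u\<close>
  in a direction \<open>d\<close> on which the normals of all other facets at \<open>y\<close> are
  positive. Three facets would contradict \<open>three_directions_in_plane\<close>.\<close>

lemma facets_with_middle_le_2:
  fixes W :: "(real^3) set"
  assumes W: "W \<subseteq> sphere c r" and "u \<noteq> 0" and "y \<in> W"
  shows "card {F. facet W F \<and> y \<in> F \<and> (\<exists>x\<in>F. u \<bullet> x < u \<bullet> y) \<and> (\<exists>z\<in>F. u \<bullet> y < u \<bullet> z)} \<le> 2"
    (is "card ?S \<le> 2")
proof (rule card_le_2I)
  define N where "N F a \<longleftrightarrow> a \<noteq> 0 \<and> (\<forall>w\<in>W. a \<bullet> y \<le> a \<bullet> w) \<and> F = {w \<in> W. a \<bullet> w = a \<bullet> y}" for F a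
  have *: "\<exists>a d. N F a \<and> u \<bullet> d = 0 \<and> a \<bullet> d = 0 \<and> (\<forall>F' a'. N F' a' \<longrightarrow> F' \<noteq> F \<longrightarrow> 0 < a' \<bullet> d)"
    if "F \<in> ?S" for F
  proof -
    obtain a b where "a \<noteq> 0" "\<forall>w\<in>W. b \<le> a \<bullet> w" "F = {w \<in> W. a \<bullet> w = b}"
      using \<open>F \<in> ?S\<close> by (auto simp: facet_def)
    then have a: "N F a"
      using \<open>F \<in> ?S\<close> by (auto simp: N_def)
    obtain x z where xz: "x \<in> F" "z \<in> F" "u \<bullet> x < u \<bullet> y" "u \<bullet> y < u \<bullet> z"
      using \<open>F \<in> ?S\<close> by blast
    \<comment> \<open>A positive combination of \<open>x - y\<close> and \<open>z - y\<close>,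
      weighted so that \<open>u\<close> vanishes on it.\<close>
    define d where "d = (u \<bullet> z - u \<bullet> y) *\<^sub>R (x - y) + (u \<bullet> y - u \<bullet> x) *\<^sub>R (z - y)"
    have ed: "e \<bullet> d = (u \<bullet> z - u \<bullet> y) * (e \<bullet> x - e \<bullet> y) + (u \<bullet> y - u \<bullet> x) * (e \<bullet> z - e \<bullet> y)" for e
      by (simp add: d_def inner_add_right inner_diff_right)
    have "0 < a' \<bullet> d" if a': "N F' a'" "F' \<noteq> F" for F' a'
    proof -
      have xzW: "x \<in> W" "z \<in> W"
        using xz a by (auto simp: N_def)
      have nonneg: "0 \<le> a' \<bullet> x - a' \<bullet> y" "0 \<le> a' \<bullet> z - a' \<bullet> y"
        using a' xzW by (auto simp: N_def)
      \<comment> \<open>Otherwise \<open>x\<close>, \<open>y\<close>, \<open>z\<close> lie on both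
        supporting planes, and three points of a sphere determine the facet.\<close>
      have "\<not> (a' \<bullet> x = a' \<bullet> y \<and> a' \<bullet> z = a' \<bullet> y)"
      proof
        assume "a' \<bullet> x = a' \<bullet> y \<and> a' \<bullet> z = a' \<bullet> y"
        moreover have "y \<noteq> x" "y \<noteq> z" "x \<noteq> z"
          using xz by auto
        ultimately have "{w \<in> W. a \<bullet> w = a \<bullet> y} = {w \<in> W. a' \<bullet> w = a' \<bullet> y}"
          using planes_through_three_points_eq[OF W, of y x z a "a \<bullet> y" a' "a' \<bullet> y"]
            \<open>y \<in> W\<close> xzW xz a a' by (auto simp: N_def)
        then show False
          using a a' by (simp add: N_def)
      qed
      then consider "0 < a' \<bullet> x - a' \<bullet> y" | "0 < a' \<bullet> z - a' \<bullet> y"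
        using nonneg by linarith
      then show ?thesis
      proof cases
        case 1
        then show ?thesis
          unfolding ed using nonneg xz by (intro add_pos_nonneg mult_pos_pos mult_nonneg_nonneg) auto
      next
        case 2
        then show ?thesis
          unfolding ed using nonneg xz by (intro add_nonneg_pos mult_pos_pos mult_nonneg_nonneg) auto
      qed
    qed
    moreover have "u \<bullet> d = 0"
      unfolding ed by (simp add: algebra_simps)
    moreover have "a \<bullet> d = 0"
      unfolding ed using xz a by (auto simp: N_def)
    ultimately show ?thesis
      using a by blast
  qed
  fix F1 F2 F3
  assume F: "F1 \<in> ?S" "F2 \<in> ?S" "F3 \<in> ?S" and d: "F1 \<noteq> F2" "F1 \<noteq> F3" "F2 \<noteq> F3"
  obtain a1 d1 where 1: "N F1 a1" "u \<bullet> d1 = 0" "a1 \<bullet> d1 = 0"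
    "\<And>F' a'. N F' a' \<Longrightarrow> F' \<noteq> F1 \<Longrightarrow> 0 < a' \<bullet> d1"
    using *[OF F(1)] by blast
  obtain a2 d2 where 2: "N F2 a2" "u \<bullet> d2 = 0" "a2 \<bullet> d2 = 0"
    "\<And>F' a'. N F' a' \<Longrightarrow> F' \<noteq> F2 \<Longrightarrow> 0 < a' \<bullet> d2"
    using *[OF F(2)] by blast
  obtain a3 d3 where 3: "N F3 a3" "u \<bullet> d3 = 0" "a3 \<bullet> d3 = 0"
    "\<And>F' a'. N F' a' \<Longrightarrow> F' \<noteq> F3 \<Longrightarrow> 0 < a' \<bullet> d3"
    using *[OF F(3)] by blast
  show False
    using three_directions_in_plane[OF \<open>u \<noteq> 0\<close> 1(2) 2(2) 3(2) 1(3) _ _ 2(3) _ _ 3(3)]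
      1(4)[OF 2(1)] 1(4)[OF 3(1)] 2(4)[OF 1(1)] 2(4)[OF 3(1)] 3(4)[OF 1(1)] 3(4)[OF 2(1)] d
    by auto
qed

section \<open>Double counting of middle vertices\<close>

lemma sum_card_swap:
  assumes "finite A" "finite B"
  shows "(\<Sum>a\<in>A. card {b \<in> B. P a b}) = (\<Sum>b\<in>B. card {a \<in> A. P a b})"
  using sum.swap_restrict[OF assms, of "\<lambda>_ _. 1::nat" P] by simp

lemma finite_facets: "finite W \<Longrightarrow> finite {F. facet W F}"
  by (rule finite_subset[of _ "Pow W"]) (auto simp: facet_def)

lemma sum_facet_sizes_le:
  fixes W :: "(real^3) set"
  assumes W: "W \<subseteq> sphere c r" and fin: "finite W" and "2 \<le> card W"
  shows "(\<Sum>F | facet W F. card F - 2) \<le> 2 * (card W - 2)"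
proof -
  obtain u where inj: "inj_on ((\<bullet>) u) W" and "u \<noteq> 0"
    using exists_injective_direction[OF fin] .
  define M where "M F = {y \<in> F. (\<exists>x\<in>F. u \<bullet> x < u \<bullet> y) \<and> (\<exists>z\<in>F. u \<bullet> y < u \<bullet> z)}" for F
  have card_M: "card F - 2 \<le> card (M F)" if "facet W F" for F
  proof -
    have "F \<subseteq> W"
      using that by (auto simp: facet_def)
    then have "finite F"
      using fin finite_subset by blast
    \<comment> \<open>By injectivity of \<open>u\<close> on \<open>W\<close>, the lowest and the
      highest point of \<open>F\<close> are unique, so at most two points of \<open>F\<close> are
      missing from \<open>M F\<close>.\<close>
    let ?lo = "{y \<in> F. \<forall>x\<in>F. u \<bullet> y \<le> u \<bullet> x}" and ?hi = "{y \<in> F. \<forall>x\<in>F. u \<bullet> x \<le> u \<bullet> y}"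
    have le_1: "card S \<le> Suc 0" if "S \<subseteq> F" "\<And>x y. x \<in> S \<Longrightarrow> y \<in> S \<Longrightarrow> u \<bullet> x = u \<bullet> y" for S
    proof -
      have "finite S"
        using that \<open>finite F\<close> finite_subset by blast
      moreover have "\<forall>x\<in>S. \<forall>y\<in>S. x = y"
        using that \<open>F \<subseteq> W\<close> inj_onD[OF inj] by blast
      ultimately show ?thesis
        by (simp add: card_le_Suc0_iff_eq)
    qed
    have "card ?lo \<le> Suc 0" "card ?hi \<le> Suc 0"
      by (rule le_1; auto simp: order.eq_iff)+
    moreover have "F = M F \<union> ?lo \<union> ?hi"
      by (auto simp: M_def) (meson not_le)+
    then have "card F = card (M F \<union> ?lo \<union> ?hi)"
      by simp
    then have "card F \<le> card (M F) + card ?lo + card ?hi"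
      using card_Un_le[of "M F \<union> ?lo" ?hi] card_Un_le[of "M F" ?lo] by linarith
    ultimately show ?thesis
      by simp
  qed
  have card_MW: "card (M W) \<le> card W - 2"
  proof -
    have ne: "W \<noteq> {}"
      using assms by auto
    obtain lo where lo: "lo \<in> W" "\<forall>x\<in>W. u \<bullet> lo \<le> u \<bullet> x"
      using ex_is_arg_min_if_finite[OF fin ne, of "(\<bullet>) u"] by (auto simp: is_arg_min_def not_less)
    obtain hi where hi: "hi \<in> W" "\<forall>x\<in>W. u \<bullet> x \<le> u \<bullet> hi"
      using ex_is_arg_min_if_finite[OF fin ne, of "\<lambda>x. - (u \<bullet> x)"] by (auto simp: is_arg_min_def not_less)
    have "lo \<noteq> hi"
    proof
      assume "lo = hi"
      then have "\<forall>x\<in>W. u \<bullet> x = u \<bullet> lo"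
        using lo(2) hi(2) by (blast intro: order_antisym)
      then have "W \<subseteq> {lo}"
        using inj_onD[OF inj _ _ lo(1)] by blast
      then have "card W \<le> 1"
        using card_mono[of "{lo}" W] by simp
      then show False
        using assms by simp
    qed
    moreover have "M W \<subseteq> W - {lo, hi}"
      using lo hi by (auto simp: M_def not_le[symmetric])
    then have "card (M W) \<le> card (W - {lo, hi})"
      using fin by (intro card_mono) auto
    ultimately show ?thesis
      using lo hi fin by (simp add: card_Diff_subset)
  qed
  \<comment> \<open>A middle vertex of a facet is also a middle vertex of \<open>W\<close>, so the
    top and the bottom of \<open>W\<close> contribute nothing.\<close>
  have M_sub: "M F = {y \<in> M W. y \<in> M F}" if "facet W F" for F
    using that by (auto simp: M_def facet_def)
  have "(\<Sum>F | facet W F. card F - 2) \<le> (\<Sum>F | facet W F. card {y \<in> M W. y \<in> M F})"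
    using card_M M_sub by (intro sum_mono) fastforce
  also have "\<dots> = (\<Sum>y\<in>M W. card {F \<in> {F. facet W F}. y \<in> M F})"
    by (rule sum_card_swap) (use fin finite_facets in \<open>auto simp: M_def\<close>)
  also have "\<dots> \<le> (\<Sum>y\<in>M W. 2)"
    using facets_with_middle_le_2[OF W \<open>u \<noteq> 0\<close>]
    by (intro sum_mono) (auto simp: M_def)
  finally show ?thesis
    using card_MW by simp
qed

text \<open>The supporting plane of the edge is rotated about the edge, in both senses, until it
  first hits a further point of \<open>W\<close>.\<close>

lemma exposed_edge_in_two_facets:
  fixes W :: "(real^3) set"
  assumes fin: "finite W" and "3 \<le> card W" and edge: "exposed_edge W x y"
    and not_coplanar: "\<And>a b. a \<noteq> 0 \<Longrightarrow> \<exists>w\<in>W. a \<bullet> w \<noteq> b"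
  shows "2 \<le> card {F. facet W F \<and> x \<in> F \<and> y \<in> F}"
proof -
  define K where "K = W - {x, y}"
  obtain a where xy: "x \<in> W" "y \<in> W" "x \<noteq> y"
    and a: "a \<bullet> (y - x) = 0" "\<And>w. w \<in> K \<Longrightarrow> 0 < a \<bullet> (w - x)"
    using edge by (auto simp: exposed_edge_def K_def)
  have "card K = card W - 2"
    using xy fin by (simp add: K_def card_Diff_subset)
  then have "K \<noteq> {}"
    using assms(2) by auto
  then have "a \<noteq> 0"
    using a(2) by auto
  have "finite K"
    using fin by (simp add: K_def)
  have rotate: "\<exists>F t. facet W F \<and> x \<in> F \<and> y \<in> F \<and> F \<inter> K \<noteq> {} \<and>
      (\<forall>w\<in>K. n \<bullet> (w - x) \<le> t * (a \<bullet> (w - x)) \<and>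
        (w \<in> F \<longleftrightarrow> n \<bullet> (w - x) = t * (a \<bullet> (w - x))))"
    if n: "n \<bullet> (y - x) = 0" "a \<bullet> n = 0" "n \<noteq> 0" for n
  proof -
    \<comment> \<open>The least \<open>t\<close> for which \<open>t *\<^sub>R a - n\<close> still
      supports \<open>W\<close> at \<open>x\<close>; a maximiser \<open>w0\<close> is the third
      point on the new plane.\<close>
    define t where "t = Max ((\<lambda>w. n \<bullet> (w - x) / (a \<bullet> (w - x))) ` K)"
    have "t \<in> (\<lambda>w. n \<bullet> (w - x) / (a \<bullet> (w - x))) ` K"
      unfolding t_def using \<open>finite K\<close> \<open>K \<noteq> {}\<close> by (intro Max_in) auto
    then obtain w0 where w0: "w0 \<in> K" "n \<bullet> (w0 - x) = t * (a \<bullet> (w0 - x))"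
      using a(2) by force
    have le: "n \<bullet> (w - x) \<le> t * (a \<bullet> (w - x))" if "w \<in> K" for w
    proof -
      have "n \<bullet> (w - x) / (a \<bullet> (w - x)) \<le> t"
        unfolding t_def using \<open>finite K\<close> that by (intro Max_ge) auto
      then show ?thesis
        using a(2)[OF that] by (simp add: pos_divide_le_eq)
    qed
    define g where "g = t *\<^sub>R a - n"
    have g: "g \<bullet> w = g \<bullet> x + (t * (a \<bullet> (w - x)) - n \<bullet> (w - x))" for w
      by (simp add: g_def inner_diff_left inner_diff_right algebra_simps)
    have "g \<bullet> n \<noteq> 0"
      using n by (simp add: g_def inner_diff_left)
    then have "g \<noteq> 0"
      by auto
    define F where "F = {w \<in> W. g \<bullet> w = g \<bullet> x}"
    have F: "x \<in> F" "y \<in> F" "w0 \<in> F"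
      using xy w0 a n g[of y] g[of w0] by (auto simp: F_def K_def)
    have "finite F"
      using fin by (simp add: F_def)
    have "{x, y, w0} \<subseteq> F" "card {x, y, w0} = 3"
      using F xy w0 by (auto simp: K_def)
    then have "3 \<le> card F"
      using \<open>finite F\<close> by (metis card_mono)
    moreover have "g \<bullet> x \<le> g \<bullet> w" if "w \<in> W" for w
      using le[of w] g[of w] a n that by (cases "w \<in> K") (auto simp: K_def)
    ultimately have "facet W F"
      unfolding facet_def using \<open>g \<noteq> 0\<close> F_def by blast
    moreover have "w \<in> F \<longleftrightarrow> n \<bullet> (w - x) = t * (a \<bullet> (w - x))" if "w \<in> K" for w
      using that g[of w] by (auto simp: F_def K_def)
    ultimately show ?thesis
      using F w0 le by blast
  qed
  \<comment> \<open>Orthogonal to the edge and to \<open>a\<close>: tilting \<open>a\<close> towards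
    \<open>n\<close> or \<open>- n\<close> keeps the edge in the plane.\<close>
  define n where "n = cross3 (y - x) a"
  have n: "n \<bullet> (y - x) = 0" "a \<bullet> n = 0"
    by (simp_all add: n_def dot_cross_self)
  have "n \<noteq> 0"
  proof
    assume "n = 0"
    then obtain t where "a = t *\<^sub>R (y - x)"
      using xy by (auto simp: n_def cross_eq_0 collinear_lemma)
    then show False
      using a(1) xy \<open>a \<noteq> 0\<close> by auto
  qed
  obtain F s where F: "facet W F" "x \<in> F" "y \<in> F" "F \<inter> K \<noteq> {}"
    "\<And>w. w \<in> K \<Longrightarrow> n \<bullet> (w - x) \<le> s * (a \<bullet> (w - x))"
    "\<And>w. w \<in> K \<Longrightarrow> w \<in> F \<longleftrightarrow> n \<bullet> (w - x) = s * (a \<bullet> (w - x))"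
    using rotate[OF n \<open>n \<noteq> 0\<close>] by blast
  obtain G t where G: "facet W G" "x \<in> G" "y \<in> G" "G \<inter> K \<noteq> {}"
    "\<And>w. w \<in> K \<Longrightarrow> - n \<bullet> (w - x) \<le> t * (a \<bullet> (w - x))"
    "\<And>w. w \<in> K \<Longrightarrow> w \<in> G \<longleftrightarrow> - n \<bullet> (w - x) = t * (a \<bullet> (w - x))"
    using rotate[of "- n"] n \<open>n \<noteq> 0\<close> by auto
  \<comment> \<open>A common third point forces \<open>t = - s\<close>. The two opposite families of
    inequalities then become equalities, which puts all of \<open>W\<close> in one plane.\<close>
  have "F \<noteq> G"
  proof
    assume "F = G"
    then obtain w where w: "w \<in> K" "w \<in> F" "w \<in> G"
      using F(4) by blast
    then have "s * (a \<bullet> (w - x)) = - t * (a \<bullet> (w - x))"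
      using F(6) G(6) by auto
    then have "(s + t) * (a \<bullet> (w - x)) = 0"
      by (simp add: algebra_simps)
    then have "t = - s"
      using a(2)[OF w(1)] by simp
    then have eq: "n \<bullet> (w - x) = s * (a \<bullet> (w - x))" if "w \<in> K" for w
      using F(5)[OF that] G(5)[OF that] by auto
    define g where "g = s *\<^sub>R a - n"
    have "g \<bullet> n \<noteq> 0"
      using n \<open>n \<noteq> 0\<close> by (simp add: g_def inner_diff_left)
    then have "g \<noteq> 0"
      by auto
    have g: "g \<bullet> w = g \<bullet> x + (s * (a \<bullet> (w - x)) - n \<bullet> (w - x))" for w
      by (simp add: g_def inner_diff_left inner_diff_right algebra_simps)
    have "g \<bullet> w = g \<bullet> x" if "w \<in> W" for w
      using eq[of w] g[of w] a n that by (cases "w \<in> K") (auto simp: K_def)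
    then show False
      using not_coplanar[OF \<open>g \<noteq> 0\<close>, of "g \<bullet> x"] by auto
  qed
  then have "card {F, G} = 2" "{F, G} \<subseteq> {F. facet W F \<and> x \<in> F \<and> y \<in> F}"
    using F G by auto
  moreover have "finite {F. facet W F \<and> x \<in> F \<and> y \<in> F}"
    using finite_facets[OF fin] by (rule rev_finite_subset) auto
  ultimately show ?thesis
    by (metis card_mono)
qed

section \<open>Bichromatic edges of a polytope inscribed in a sphere\<close>

definition bipartite_edges :: "'a::real_inner set \<Rightarrow> 'a set \<Rightarrow> ('a \<times> 'a) set" where
  "bipartite_edges R B = {(x, y) \<in> R \<times> B. exposed_edge (R \<union> B) x y}"

lemma finite_bipartite_edges: "finite R \<Longrightarrow> finite B \<Longrightarrow> finite (bipartite_edges R B)"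
  unfolding bipartite_edges_def by (rule finite_subset[of _ "R \<times> B"]) auto

text \<open>Degrees are at most 2, so the number of edges is at most twice the smaller colour class,
  hence at most \<open>card F\<close>; this suffices from four points on. For three points the
  product of the class sizes is at most 2.\<close>

lemma bipartite_edges_in_plane_le:
  fixes R B F :: "(real^3) set"
  assumes fin: "finite R" "finite B" and disj: "R \<inter> B = {}"
    and F: "F \<subseteq> R \<union> B" "3 \<le> card F"
    and a: "a \<noteq> 0" "\<And>w. w \<in> F \<Longrightarrow> a \<bullet> w = b"
  shows "card {(x, y) \<in> bipartite_edges R B. x \<in> F \<and> y \<in> F} \<le> 2 * (card F - 2)"
proof -
  let ?W = "R \<union> B" and ?E = "{(x, y) \<in> bipartite_edges R B. x \<in> F \<and> y \<in> F}"
  define R' where "R' = R \<inter> F"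
  define B' where "B' = B \<inter> F"
  have fin': "finite R'" "finite B'"
    using fin by (auto simp: R'_def B'_def)
  have "F = R' \<union> B'" "R' \<inter> B' = {}"
    using F disj by (auto simp: R'_def B'_def)
  then have card_F: "card F = card R' + card B'"
    using fin' by (simp add: card_Un_disjoint)
  have E: "?E = Sigma R' (\<lambda>x. {y \<in> B'. exposed_edge ?W x y})"
    by (auto simp: bipartite_edges_def R'_def B'_def)
  have deg: "card {y \<in> F. exposed_edge ?W x y} \<le> 2" if "x \<in> F" for x
    using exposed_degree_in_plane[OF a F(1) that] .
  have finF: "finite F"
    using \<open>F = R' \<union> B'\<close> fin' by simp
  have degR: "card {y \<in> B'. exposed_edge ?W x y} \<le> 2" if "x \<in> R'" for x
    using that finF by (intro order.trans[OF card_mono deg[of x]]) (auto simp: R'_def B'_def)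
  have degB: "card {x \<in> R'. exposed_edge ?W x y} \<le> 2" if "y \<in> B'" for y
    using that finF
    by (intro order.trans[OF card_mono deg[of y]]) (auto simp: R'_def B'_def exposed_edge_commute)
  have card_E: "card ?E = (\<Sum>x\<in>R'. card {y \<in> B'. exposed_edge ?W x y})"
    unfolding E using fin' by (simp add: card_SigmaI)
  then have 1: "card ?E \<le> 2 * card R'"
    using sum_bounded_above[of R', OF degR] by (simp add: mult.commute)
  have 2: "card ?E \<le> 2 * card B'"
    unfolding card_E sum_card_swap[OF fin'] using sum_bounded_above[of B', OF degB] by (simp add: mult.commute)
  have "?E \<subseteq> R' \<times> B'"
    unfolding E by auto
  from card_mono[OF _ this] have 3: "card ?E \<le> card R' * card B'"
    using fin' by (simp add: card_cartesian_product)
  show ?thesis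
  proof (cases "4 \<le> card F")
    case True
    then show ?thesis
      using 1 2 card_F by linarith
  next
    case False
    then have "card R' + card B' = 3"
      using F card_F by simp
    then consider "card R' = 0" | "card R' = 1" "card B' = 2" | "card R' = 2" "card B' = 1" | "card B' = 0"
      by linarith
    then have "card R' * card B' \<le> 2"
      by cases auto
    then show ?thesis
      using 3 F(2) by linarith
  qed
qed

text \<open>Counting incidences of bichromatic edges with facets gives twice the number of edges as
  a lower bound and four times \<open>card (R \<union> B) - 2\<close> as an upper bound.\<close>

lemma card_bipartite_edges_le:
  fixes R B :: "(real^3) set"
  assumes fin: "finite R" "finite B" and disj: "R \<inter> B = {}"
    and sphere: "R \<union> B \<subseteq> sphere c r" and card: "3 \<le> card (R \<union> B)"
  shows "card (bipartite_edges R B) \<le> 2 * (card (R \<union> B) - 2)"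
proof (cases "\<exists>a b. a \<noteq> 0 \<and> (\<forall>w\<in>R \<union> B. a \<bullet> w = b)")
  \<comment> \<open>For coplanar points an edge need not lie in two facets, but the planar bound
    applies to the whole set.\<close>
  case True
  then obtain a b where "a \<noteq> 0" "\<And>w. w \<in> R \<union> B \<Longrightarrow> a \<bullet> w = b"
    by blast
  from bipartite_edges_in_plane_le[OF fin disj order.refl card this]
  have "card {(x, y) \<in> bipartite_edges R B. x \<in> R \<union> B \<and> y \<in> R \<union> B} \<le> 2 * (card (R \<union> B) - 2)" .
  moreover have "{(x, y) \<in> bipartite_edges R B. x \<in> R \<union> B \<and> y \<in> R \<union> B} = bipartite_edges R B"
    by (auto simp: bipartite_edges_def)
  ultimately show ?thesis
    by simp
next
  case False
  let ?W = "R \<union> B" and ?E = "bipartite_edges R B"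
  have finW: "finite ?W"
    using fin by simp
  have "2 * card ?E = (\<Sum>e\<in>?E. 2)"
    by simp
  also have "\<dots> \<le> (\<Sum>e\<in>?E. card {F \<in> {F. facet ?W F}. fst e \<in> F \<and> snd e \<in> F})"
  proof (rule sum_mono)
    fix e assume "e \<in> ?E"
    then have "exposed_edge ?W (fst e) (snd e)"
      by (auto simp: bipartite_edges_def)
    then have "2 \<le> card {F. facet ?W F \<and> fst e \<in> F \<and> snd e \<in> F}"
      by (rule exposed_edge_in_two_facets[OF finW card]) (use False in blast)
    then show "2 \<le> card {F \<in> {F. facet ?W F}. fst e \<in> F \<and> snd e \<in> F}"
      by simp
  qed
  also have "\<dots> = (\<Sum>F | facet ?W F. card {e \<in> ?E. fst e \<in> F \<and> snd e \<in> F})"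
    by (intro sum_card_swap finite_facets finite_bipartite_edges finW fin)
  also have "\<dots> \<le> (\<Sum>F | facet ?W F. 2 * (card F - 2))"
  proof (rule sum_mono)
    fix F assume "F \<in> {F. facet ?W F}"
    then obtain a b where "3 \<le> card F" "a \<noteq> 0" and F: "F = {w \<in> ?W. a \<bullet> w = b}"
      by (auto simp: facet_def)
    moreover from F have "F \<subseteq> ?W" "\<And>w. w \<in> F \<Longrightarrow> a \<bullet> w = b"
      by auto
    ultimately have "F \<subseteq> ?W" "3 \<le> card F" "a \<noteq> 0" "\<And>w. w \<in> F \<Longrightarrow> a \<bullet> w = b"
      by blast+
    from bipartite_edges_in_plane_le[OF fin disj this]
    have "card {(x, y) \<in> ?E. x \<in> F \<and> y \<in> F} \<le> 2 * (card F - 2)" .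
    moreover have "{(x, y) \<in> ?E. x \<in> F \<and> y \<in> F} = {e \<in> ?E. fst e \<in> F \<and> snd e \<in> F}"
      by auto
    ultimately show "card {e \<in> ?E. fst e \<in> F \<and> snd e \<in> F} \<le> 2 * (card F - 2)"
      by simp
  qed
  also have "\<dots> = 2 * (\<Sum>F | facet ?W F. card F - 2)"
    by (simp add: sum_distrib_left)
  also have "\<dots> \<le> 2 * (2 * (card ?W - 2))"
    using sum_facet_sizes_le[OF sphere finW] card by simp
  finally show ?thesis
    by simp
qed

section \<open>From double normals to edges between a set and its antipodal copy\<close>

definition strict_double_normal_rel :: "'a::real_inner set \<Rightarrow> ('a \<times> 'a) set" where
  "strict_double_normal_rel V = {(p, q). strict_double_normal V p q}"

lemma strict_double_normal_rel_subset: "strict_double_normal_rel V \<subseteq> V \<times> V"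
  by (auto simp: strict_double_normal_rel_def strict_double_normal_def)

lemma finite_strict_double_normal_rel: "finite V \<Longrightarrow> finite (strict_double_normal_rel V)"
  using strict_double_normal_rel_subset by (rule finite_subset) simp

lemma finite_strict_double_normal_pairs: "finite V \<Longrightarrow> finite (strict_double_normal_pairs V)"
  by (rule finite_subset[of _ "Pow V"])
    (auto simp: strict_double_normal_pairs_def strict_double_normal_def)

text \<open>Each pair has two orientations, which later correspond to its two edges.\<close>

lemma card_strict_double_normal_rel:
  assumes "finite V"
  shows "card (strict_double_normal_rel V) = 2 * num_strict_double_normals V"
proof -
  let ?E = "strict_double_normal_rel V" and ?P = "strict_double_normal_pairs V"
  have "card ?E = (\<Sum>e\<in>?E. card {s \<in> ?P. s = {fst e, snd e}})"
  proof -
    have "{s \<in> ?P. s = {fst e, snd e}} = {{fst e, snd e}}" if "e \<in> ?E" for e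
      using that unfolding strict_double_normal_rel_def strict_double_normal_pairs_def by force
    then show ?thesis
      by simp
  qed
  also have "\<dots> = (\<Sum>s\<in>?P. card {e \<in> ?E. s = {fst e, snd e}})"
    by (intro sum_card_swap finite_strict_double_normal_rel finite_strict_double_normal_pairs assms)
  also have "\<dots> = (\<Sum>s\<in>?P. 2)"
  proof (rule sum.cong)
    fix s assume "s \<in> ?P"
    then obtain p q where s: "s = {p, q}" and pq: "strict_double_normal V p q"
      by (auto simp: strict_double_normal_pairs_def)
    then have "strict_double_normal V q p" "p \<noteq> q"
      using strict_double_normal_commute by (auto simp: strict_double_normal_def)
    then have "{e \<in> ?E. s = {fst e, snd e}} = {(p, q), (q, p)}"
      using pq unfolding s by (auto simp: strict_double_normal_rel_def doubleton_eq_iff)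
    then show "card {e \<in> ?E. s = {fst e, snd e}} = 2"
      using \<open>p \<noteq> q\<close> by simp
  qed simp
  finally show ?thesis
    by (simp add: num_strict_double_normals_def)
qed

definition antipode :: "'a::real_inner \<Rightarrow> 'a \<Rightarrow> 'a" where
  "antipode c x = 2 *\<^sub>R c - x"

lemma antipode_antipode [simp]: "antipode c (antipode c x) = x"
  by (simp add: antipode_def)

lemma inj_antipode: "inj_on (antipode c) V"
  by (metis antipode_antipode inj_onI)

lemma antipode_in_sphere: "x \<in> sphere c r \<Longrightarrow> antipode c x \<in> sphere c r"
  by (simp add: antipode_def dist_norm scaleR_2 norm_minus_commute)

text \<open>Thales: the diameter from \<open>p\<close> to its antipode is seen from \<open>q\<close>
  under a right angle.\<close>

lemma sphere_chord_orthogonal: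
  assumes "p \<in> sphere c r" "q \<in> sphere c r"
  shows "(q - p) \<bullet> (antipode c p - q) = 0"
proof -
  have "norm (p - c) = norm (q - c)"
    using assms by (simp add: dist_norm norm_minus_commute)
  then have "(p - c) \<bullet> (p - c) = (q - c) \<bullet> (q - c)"
    by (simp add: dot_square_norm)
  then show ?thesis
    by (simp add: antipode_def inner_diff_left inner_diff_right inner_commute algebra_simps scaleR_2)
qed

text \<open>By Thales the antipode of \<open>p\<close> lies on the boundary plane through
  \<open>q\<close>, hence not in the open strip, so it can only be \<open>q\<close> itself.\<close>

lemma strict_double_normal_antipode:
  assumes V: "V \<subseteq> sphere c r" and pq: "strict_double_normal V p q" and "antipode c p \<in> V" "r > 0"
  shows "q = antipode c p"
proof (rule ccontr)
  assume "q \<noteq> antipode c p"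
  moreover have "antipode c p \<noteq> p"
  proof
    assume "antipode c p = p"
    then have "2 *\<^sub>R p = 2 *\<^sub>R c"
      by (simp add: antipode_def scaleR_2 algebra_simps)
    then have "p = c"
      by simp
    then show False
      using V pq \<open>r > 0\<close> by (auto simp: strict_double_normal_def)
  qed
  ultimately have "(q - p) \<bullet> (antipode c p - q) < 0"
    using pq assms(3) by (auto simp: strict_double_normal_def open_strip_def)
  moreover have "(q - p) \<bullet> (antipode c p - q) = 0"
    using pq V unfolding strict_double_normal_def by (intro sphere_chord_orthogonal) blast+
  ultimately show False
    by simp
qed

text \<open>The cap of the sphere beyond the plane through \<open>q\<close> is the antipodal image of the cap beyond
  the plane through \<open>p\<close>, so both caps miss \<open>V\<close> iff one of them misses \<open>V\<close> and its antipodal copy.\<close>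

lemma strict_double_normal_imp_exposed_edge:
  assumes V: "V \<subseteq> sphere c r" and pq: "strict_double_normal V p q"
    and disj: "V \<inter> antipode c ` V = {}"
  shows "exposed_edge (V \<union> antipode c ` V) p (antipode c q)"
  unfolding exposed_edge_def
\<comment> \<open>The plane through \<open>p\<close> perpendicular to the segment also contains the
  antipode of \<open>q\<close>, so \<open>q - p\<close> serves as the exposing functional.\<close>
proof (intro conjI exI[of _ "q - p"] ballI)
  have pV: "p \<in> V" "q \<in> V" "p \<noteq> q"
    using pq by (auto simp: strict_double_normal_def)
  then show "p \<in> V \<union> antipode c ` V" "antipode c q \<in> V \<union> antipode c ` V" "p \<noteq> antipode c q"
    using disj by auto
  have "(p - q) \<bullet> (antipode c q - p) = 0"
    using pV V by (intro sphere_chord_orthogonal) blast+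
  then show eq: "(q - p) \<bullet> (antipode c q - p) = 0"
    by (simp add: inner_diff_left)
  have sq: "0 < (q - p) \<bullet> (q - p)"
    using pV by simp
  fix w assume w: "w \<in> V \<union> antipode c ` V - {p, antipode c q}"
  then consider "w \<in> V - {p, q}" | "w = q" | "w = antipode c p"
    | x where "x \<in> V - {p, q}" "w = antipode c x"
    by blast
  then show "0 < (q - p) \<bullet> (w - p)"
  proof cases
    case 1
    then show ?thesis
      using pq by (auto simp: strict_double_normal_def open_strip_def)
  next
    case 2
    then show ?thesis
      using sq by simp
  next
    case 3
    then have "(q - p) \<bullet> (w - p) = (q - p) \<bullet> (antipode c q - p) + (q - p) \<bullet> (q - p)"
      by (simp add: antipode_def inner_diff_right)
    then show ?thesis
      using eq sq by simp
  next
    case 4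
    then have "(q - p) \<bullet> (w - p) = (q - p) \<bullet> (antipode c q - p) - (q - p) \<bullet> (x - q)"
      by (simp add: antipode_def inner_diff_right)
    moreover have "(q - p) \<bullet> (x - q) < 0"
      using 4 pq by (auto simp: strict_double_normal_def open_strip_def)
    ultimately show ?thesis
      using eq by simp
  qed
qed

text \<open>Sending \<open>(p, q)\<close> to \<open>p\<close> and the antipode of \<open>q\<close>
  is an injection into the bichromatic edges of a set of \<open>2 * card V\<close> points.\<close>

lemma card_strict_double_normal_rel_le_if_no_antipodes:
  fixes V :: "(real^3) set"
  assumes fin: "finite V" and V: "V \<subseteq> sphere c r" and "2 \<le> card V"
    and disj: "V \<inter> antipode c ` V = {}"
  shows "card (strict_double_normal_rel V) \<le> 4 * card V - 4"
proof -
  let ?V' = "antipode c ` V"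
  have card: "card (V \<union> ?V') = 2 * card V"
    using fin disj by (simp add: card_Un_disjoint card_image inj_antipode)
  have "card (strict_double_normal_rel V) \<le> card (bipartite_edges V ?V')"
  proof (rule card_inj_on_le)
    show "inj_on (map_prod id (antipode c)) (strict_double_normal_rel V)"
      by (rule inj_on_subset[of _ UNIV]) (auto simp: inj_antipode intro: prod.inj_map)
    show "map_prod id (antipode c) ` strict_double_normal_rel V \<subseteq> bipartite_edges V ?V'"
      using strict_double_normal_imp_exposed_edge[OF V _ disj]
      by (auto simp: strict_double_normal_rel_def bipartite_edges_def)
        (auto simp: strict_double_normal_def)
    show "finite (bipartite_edges V ?V')"
      using fin by (simp add: finite_bipartite_edges)
  qed
  also have "\<dots> \<le> 2 * (card (V \<union> ?V') - 2)"
    using fin V disj card \<open>2 \<le> card V\<close>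
    by (intro card_bipartite_edges_le[where c = c and r = r])
      (auto simp del: mem_sphere intro!: antipode_in_sphere)
  finally show ?thesis
    using card by simp
qed

text \<open>Points of \<open>A\<close> are paired only with their own antipodes, so they add at most
  \<open>card A\<close> ordered pairs; all other pairs survive as double normals of
  \<open>U\<close>.\<close>

lemma card_strict_double_normal_rel_le:
  fixes V :: "(real^3) set"
  assumes fin: "finite V" and V: "V \<subseteq> sphere c r" and "2 \<le> card V" and "r > 0"
  shows "card (strict_double_normal_rel V) \<le> 4 * card V - 4"
proof -
  define A where "A = {p \<in> V. antipode c p \<in> V}"
  define U where "U = V - A"
  have card: "card V = card U + card A" "finite A" "finite U" "U \<subseteq> V"
    using fin by (auto simp: U_def A_def card_Diff_subset card_mono)
  have "strict_double_normal_rel V \<subseteq> strict_double_normal_rel U \<union> (\<lambda>p. (p, antipode c p)) ` A"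
  proof
    fix e assume "e \<in> strict_double_normal_rel V"
    then obtain p q where e: "e = (p, q)" "strict_double_normal V p q"
      by (auto simp: strict_double_normal_rel_def)
    then have pq: "strict_double_normal V q p" "p \<in> V" "q \<in> V"
      using strict_double_normal_commute by (auto simp: strict_double_normal_def)
    consider "p \<in> A" | "q \<in> A" | "p \<in> U" "q \<in> U"
      using pq by (auto simp: U_def)
    then show "e \<in> strict_double_normal_rel U \<union> (\<lambda>p. (p, antipode c p)) ` A"
    proof cases
      case 1
      then have "q = antipode c p"
        using strict_double_normal_antipode[OF V e(2)] \<open>r > 0\<close> by (simp add: A_def)
      then show ?thesis
        using 1 e by auto
    next
      case 2
      then have "p = antipode c q"
        using strict_double_normal_antipode[OF V pq(1)] \<open>r > 0\<close> by (simp add: A_def)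
      then show ?thesis
        using 2 e pq by (auto simp: A_def)
    next
      case 3
      then show ?thesis
        using e \<open>U \<subseteq> V\<close> by (auto simp: strict_double_normal_rel_def strict_double_normal_def)
    qed
  qed
  then have "card (strict_double_normal_rel V) \<le>
      card (strict_double_normal_rel U \<union> (\<lambda>p. (p, antipode c p)) ` A)"
    using card by (intro card_mono finite_UnI finite_imageI finite_strict_double_normal_rel)
  then have le: "card (strict_double_normal_rel V) \<le> card (strict_double_normal_rel U) + card A"
    using card_Un_le[of "strict_double_normal_rel U" "(\<lambda>p. (p, antipode c p)) ` A"]
      card_image_le[OF \<open>finite A\<close>, of "\<lambda>p. (p, antipode c p)"] by linarith
  show ?thesis
  proof (cases "2 \<le> card U")
    case True
    have "U \<inter> antipode c ` U = {}"
      by (auto simp: U_def A_def)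
    then have "card (strict_double_normal_rel U) \<le> 4 * card U - 4"
      using card_strict_double_normal_rel_le_if_no_antipodes[of U c r] True V card by auto
    then show ?thesis
      using le card True by linarith
  next
    \<comment> \<open>With at most one point left in \<open>U\<close>, only the
      \<open>card A\<close> antipodal pairs remain.\<close>
    case False
    then have "strict_double_normal_rel U = {}"
      using \<open>finite U\<close> card_le_Suc0_iff_eq[of U]
      by (auto simp: strict_double_normal_rel_def strict_double_normal_def)
    then show ?thesis
      using le card \<open>2 \<le> card V\<close> by simp
  qed
qed

section \<open>Sharp configurations\<close>

definition upper_point :: "real \<Rightarrow> real^3" where
  "upper_point x = vector [x, 0, sqrt (1 - x\<^sup>2)]"

lemma inner_vector_3: "(vector [a, b, c] :: real^3) \<bullet> vector [a', b', c'] = a * a' + b * b' + c * c'"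
  by (simp add: inner_vec_def sum_3)

lemma vector_3_diff: "(vector [a, b, c] :: real^3) - vector [a', b', c'] = vector [a - a', b - b', c - c']"
  by (simp add: vec_eq_iff forall_3)

lemma vector_3_eq_iff: "(vector [a, b, c] :: real^3) = vector [a', b', c'] \<longleftrightarrow> a = a' \<and> b = b' \<and> c = c'"
  by (auto simp: vec_eq_iff forall_3)

text \<open>All points \<open>(x, 0, z)\<close> of the arc are equidistant from \<open>(0, t, 0)\<close> and \<open>(0, - t, 0)\<close>; the
  tiny shift \<open>s\<close> breaks the antipodality of these two points without disturbing acute angles.\<close>

lemma arc_with_two_points_sharp:
  fixes X :: "real set" and s t :: real
  assumes X: "finite X" "X \<subseteq> {-1/2..1/2}" "-1/2 \<in> X" "1/2 \<in> X"
    and st: "0 < s" "0 < t" "s\<^sup>2 + t\<^sup>2 = 1"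
    and small: "\<And>x y. x \<in> X \<Longrightarrow> y \<in> X \<Longrightarrow> x \<noteq> y \<Longrightarrow>
      0 < s * (sqrt (1 - x\<^sup>2) - sqrt (1 - y\<^sup>2)) + (1 - x * y - sqrt (1 - x\<^sup>2) * sqrt (1 - y\<^sup>2))"
  defines "V \<equiv> {vector [0, t, - s], vector [0, - t, - s]} \<union> upper_point ` X"
  shows "finite V" "V \<subseteq> sphere 0 1" "card V = card X + 2" "2 * card X + 2 \<le> num_strict_double_normals V"
proof -
  let ?v = "vector [0, t, - s] :: real^3" and ?w = "vector [0, - t, - s] :: real^3"
  have abs_le: "\<bar>x\<bar> \<le> 1/2" if "x \<in> X" for x
    using that X(2) by fastforce
  have sq: "x\<^sup>2 \<le> 1/4" if "x \<in> X" for x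
  proof -
    have "\<bar>x\<bar> \<le> \<bar>1/2\<bar>"
      using abs_le[OF that] by simp
    then have "x\<^sup>2 \<le> (1/2)\<^sup>2"
      by (simp only: abs_le_square_iff)
    then show ?thesis
      by (simp add: power2_eq_square)
  qed
  have z_pos: "0 < sqrt (1 - x\<^sup>2)" and z_sq: "sqrt (1 - x\<^sup>2) * sqrt (1 - x\<^sup>2) = 1 - x * x" if "x \<in> X" for x
    using sq[OF that] by (auto simp: power2_eq_square)
  have st': "s * s + t * t = 1"
    using st by (simp add: power2_eq_square)
  show "finite V"
    using X by (simp add: V_def)
  have unit: "?v \<bullet> ?v = 1" "?w \<bullet> ?w = 1" "\<And>x. x \<in> X \<Longrightarrow> upper_point x \<bullet> upper_point x = 1"
    using st' z_sq by (simp_all add: inner_vector_3 upper_point_def)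
  then show "V \<subseteq> sphere 0 1"
    by (auto simp: V_def norm_eq_sqrt_inner)
  have inj: "inj_on upper_point X"
    by (auto simp: inj_on_def upper_point_def vector_3_eq_iff)
  have neq: "?v \<noteq> ?w" "?v \<noteq> upper_point x" "?w \<noteq> upper_point x" for x
    using st by (auto simp: upper_point_def vector_3_eq_iff)
  have "card {?v, ?w} = 2" "{?v, ?w} \<inter> upper_point ` X = {}"
    using neq by auto
  then show "card V = card X + 2"
    using X inj unfolding V_def by (subst card_Un_disjoint) (auto simp: card_image)

  have base: "strict_double_normal V ?v ?w"
    using neq st by (auto simp: strict_double_normal_def open_strip_def V_def upper_point_def
        vector_3_diff inner_vector_3)
  have ends: "strict_double_normal V (upper_point (-1/2)) (upper_point (1/2))"
  proof -
    \<comment> \<open>The two end points have equal height, so the strip only restricts the first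
      coordinate.\<close>
    have strip: "vector [x, y, z] \<in> open_strip (upper_point (-1/2)) (upper_point (1/2))"
      if "-1/2 < x" "x < 1/2" for x y z
      using that by (simp add: open_strip_def upper_point_def vector_3_diff inner_vector_3 power2_eq_square)
    have "upper_point x \<in> open_strip (upper_point (-1/2)) (upper_point (1/2))"
      if "x \<in> X" "x \<noteq> -1/2" "x \<noteq> 1/2" for x
    proof -
      have "-1/2 \<le> x" "x \<le> 1/2"
        using that X(2) by auto
      then show ?thesis
        unfolding upper_point_def[of x] using that by (intro strip) auto
    qed
    then have "V - {upper_point (-1/2), upper_point (1/2)} \<subseteq>
        open_strip (upper_point (-1/2)) (upper_point (1/2))"
      unfolding V_def using strip[of 0] by (intro subsetI) (fastforce simp del: minus_divide_left)
    moreover have "upper_point (-1/2) \<noteq> upper_point (1/2)"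
      by (simp add: upper_point_def vector_3_eq_iff)
    ultimately show ?thesis
      using X by (simp add: strict_double_normal_def V_def)
  qed
  have spokes: "strict_double_normal V v (upper_point x)" if v: "v \<in> {?v, ?w}" and x: "x \<in> X" for v x
  proof -
    \<comment> \<open>Writing \<open>t'\<close> for \<open>t\<close> or \<open>- t\<close> treats
      both near-poles at once.\<close>
    obtain t' where t': "v = vector [0, t', - s]" "t' \<noteq> 0" "t' * t' = t * t"
      "{?v, ?w} = {v, vector [0, - t', - s]}"
      using v st by force
    have tt: "0 < t' * t'"
      using t'(3) st by simp
    have "p \<in> open_strip v (upper_point x)" if p: "p \<in> V - {v, upper_point x}" for p
    proof -
      consider "p = vector [0, - t', - s]" | y where "y \<in> X" "y \<noteq> x" "p = upper_point y"
        using p unfolding V_def t'(4) by blast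
      then show ?thesis
      proof cases
        case 1
        \<comment> \<open>Positivity of \<open>s\<close> is decisive: for \<open>s = 0\<close> the
          other pole would lie on the boundary plane through \<open>upper_point x\<close>.\<close>
        have "0 < s * sqrt (1 - x\<^sup>2)" "0 < s * s"
          using z_pos[OF x] st by auto
        then show ?thesis
          using 1 tt z_sq[OF x] st' t'(3)
          by (simp add: open_strip_def t'(1) upper_point_def vector_3_diff inner_vector_3 algebra_simps)
      next
        case 2
        have pos: "0 < s * sqrt (1 - x\<^sup>2)" "0 < s * sqrt (1 - y\<^sup>2)"
          "0 < sqrt (1 - x\<^sup>2) * sqrt (1 - y\<^sup>2)"
          using z_pos x 2 st by auto
        have "\<bar>x * y\<bar> \<le> 1/2 * (1/2)"
          unfolding abs_mult using abs_le x 2 by (intro mult_mono) auto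
        then have xy: "- 1 < x * y"
          by linarith
        \<comment> \<open>Up to rearrangement, \<open>small\<close> says that
          \<open>upper_point y\<close> lies strictly before the plane through
          \<open>upper_point x\<close>.\<close>
        show ?thesis
          using 2 pos xy small[OF x 2(1)] z_sq[OF x] z_sq[OF 2(1)] st' t'(3)
          by (simp add: open_strip_def t'(1) upper_point_def vector_3_diff inner_vector_3 algebra_simps)
      qed
    qed
    then show ?thesis
      using v x neq by (auto simp: strict_double_normal_def V_def)
  qed
  \<comment> \<open>Two special pairs and two fans of \<open>card X\<close> spokes give
    \<open>2 * card X + 2\<close>, which is \<open>2 * card V - 2\<close>.\<close>
  define P where "P = {{?v, ?w}, {upper_point (-1/2), upper_point (1/2)}}"
  define Q where "Q v = (\<lambda>x. {v, upper_point x}) ` X" for v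
  have "P \<union> Q ?v \<union> Q ?w \<subseteq> strict_double_normal_pairs V"
    using base ends spokes by (auto simp: P_def Q_def strict_double_normal_pairs_def)
  then have "card (P \<union> Q ?v \<union> Q ?w) \<le> num_strict_double_normals V"
    unfolding num_strict_double_normals_def
    by (intro card_mono finite_strict_double_normal_pairs \<open>finite V\<close>)
  moreover have "card P = 2"
    using neq by (auto simp: P_def doubleton_eq_iff)
  moreover have "card (Q v) = card X" for v
    unfolding Q_def
  proof (rule card_image)
    show "inj_on (\<lambda>x. {v, upper_point x}) X"
      using inj by (auto simp: inj_on_def doubleton_eq_iff)
  qed
  moreover have "card (P \<union> Q ?v \<union> Q ?w) = card P + card (Q ?v) + card (Q ?w)"
  proof -
    have "finite P" "finite (Q v)" for v
      using X by (auto simp: P_def Q_def)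
    moreover have "P \<inter> Q ?v = {}" "(P \<union> Q ?v) \<inter> Q ?w = {}"
      using neq neq[symmetric] by (auto simp: P_def Q_def doubleton_eq_iff)
    ultimately show ?thesis
      by (simp add: card_Un_disjoint)
  qed
  ultimately show "2 * card X + 2 \<le> num_strict_double_normals V"
    by simp
qed

text \<open>The right-hand side is half the squared distance between the points of the unit
  half-circle above \<open>x\<close> and \<open>y\<close>.\<close>

lemma chord_positive:
  assumes "x\<^sup>2 \<le> 1" "y\<^sup>2 \<le> 1" "x \<noteq> y"
  shows "0 < 1 - x * y - sqrt (1 - x\<^sup>2) * sqrt (1 - y\<^sup>2)"
proof -
  have "0 < (x - y)\<^sup>2"
    using assms by simp
  moreover have "0 \<le> (sqrt (1 - x\<^sup>2) - sqrt (1 - y\<^sup>2))\<^sup>2"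
    by simp
  moreover have "(sqrt (1 - x\<^sup>2))\<^sup>2 = 1 - x\<^sup>2" "(sqrt (1 - y\<^sup>2))\<^sup>2 = 1 - y\<^sup>2"
    using assms by auto
  ultimately show ?thesis
    by (simp add: power2_diff)
qed

lemma exists_sharp_configuration:
  assumes "4 \<le> n"
  shows "\<exists>V :: (real^3) set. finite V \<and> card V = n \<and> V \<subseteq> sphere 0 1 \<and> 2 * n - 2 \<le> num_strict_double_normals V"
proof -
  have "infinite ({-1/2<..<1/2} :: real set)"
    by (simp add: infinite_Ioo)
  \<comment> \<open>The two ends of the arc and the two near-poles make up the other four
    points.\<close>
  then obtain Y :: "real set" where Y: "finite Y" "card Y = n - 4" "Y \<subseteq> {-1/2<..<1/2}"
    using infinite_arbitrarily_large by blast
  define X where "X = insert (-1/2) (insert (1/2) Y)"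
  have X: "finite X" "X \<subseteq> {-1/2..1/2}" "-1/2 \<in> X" "1/2 \<in> X"
    using Y by (auto simp: X_def)
  have "-1/2 \<notin> insert (1/2) Y" "1/2 \<notin> Y"
    using Y(3) by auto
  then have cardX: "card X = n - 2"
    using Y assms by (simp add: X_def)
  have sq: "x\<^sup>2 \<le> 1" if "x \<in> X" for x
    unfolding abs_square_le_1 using that X(2) by fastforce
  let ?g = "\<lambda>x y. 1 - x * y - sqrt (1 - x\<^sup>2) * sqrt (1 - y\<^sup>2)"
  \<comment> \<open>At \<open>s = 0\<close> the required inequalities hold strictly by
    \<open>chord_positive\<close>; being finitely many, they persist for all small positive
    \<open>s\<close>.\<close>
  have lim: "((\<lambda>s. s * (sqrt (1 - x\<^sup>2) - sqrt (1 - y\<^sup>2)) + ?g x y) \<longlongrightarrow> ?g x y) (at_right 0)" for x y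
    by (auto intro!: tendsto_eq_intros)
  have "\<forall>\<^sub>F s in at_right 0. \<forall>x\<in>X. \<forall>y\<in>X. x \<noteq> y \<longrightarrow>
      0 < s * (sqrt (1 - x\<^sup>2) - sqrt (1 - y\<^sup>2)) + ?g x y"
  proof (intro eventually_ball_finite ballI X)
    fix x y assume xy: "x \<in> X" "y \<in> X"
    show "\<forall>\<^sub>F s in at_right 0. x \<noteq> y \<longrightarrow>
      0 < s * (sqrt (1 - x\<^sup>2) - sqrt (1 - y\<^sup>2)) + ?g x y"
      using order_tendstoD(1)[OF lim, of 0 x y] chord_positive[of x y] sq xy
      by (cases "x = y") auto
  qed
  moreover have "\<forall>\<^sub>F s in at_right (0::real). 0 < s \<and> s < 1"
    by (intro eventually_conj eventually_at_right_less eventually_at_rightI[of 0 1]) auto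
  ultimately have "\<forall>\<^sub>F s in at_right 0. (0 < s \<and> s < 1) \<and> (\<forall>x\<in>X. \<forall>y\<in>X. x \<noteq> y \<longrightarrow>
      0 < s * (sqrt (1 - x\<^sup>2) - sqrt (1 - y\<^sup>2)) + ?g x y)"
    by (rule eventually_conj[rotated])
  then obtain s where s: "0 < s" "s < 1" "\<And>x y. x \<in> X \<Longrightarrow> y \<in> X \<Longrightarrow> x \<noteq> y \<Longrightarrow>
      0 < s * (sqrt (1 - x\<^sup>2) - sqrt (1 - y\<^sup>2)) + ?g x y"
    using eventually_happens'[OF trivial_limit_at_right_real] by blast
  have "s\<^sup>2 < 1"
    using s by (simp add: abs_square_less_1)
  then have t: "0 < sqrt (1 - s\<^sup>2)" "s\<^sup>2 + (sqrt (1 - s\<^sup>2))\<^sup>2 = 1"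
    by auto
  show ?thesis
    using arc_with_two_points_sharp[OF X s(1) t s(3)] cardX assms
    by (intro exI[of _ "{vector [0, sqrt (1 - s\<^sup>2), - s], vector [0, - sqrt (1 - s\<^sup>2), - s]} \<union> upper_point ` X"])
      auto
qed

lemma num_strict_double_normals_le:
  fixes V :: "(real^3) set"
  assumes "finite V" "4 \<le> card V" "r > 0" "V \<subseteq> sphere c r"
  shows "num_strict_double_normals V \<le> 2 * card V - 2"
  using card_strict_double_normal_rel_le[of V c r] card_strict_double_normal_rel[of V] assms
  by simp

theorem theorem2:
  shows "(\<forall>(V :: (real ^ 3) set) c r.
            finite V \<and> card V \<ge> 4 \<and> r > 0 \<and> V \<subseteq> sphere c r \<longrightarrow>
            num_strict_double_normals V \<le> 2 * card V - 2)
       \<and> (\<forall>n \<ge> 4. \<exists>(V :: (real ^ 3) set) c r.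
            finite V \<and> card V = n \<and> r > 0 \<and> V \<subseteq> sphere c r \<and>
            num_strict_double_normals V = 2 * n - 2)"
proof (intro conjI allI impI)
  fix n :: nat assume "4 \<le> n"
  then obtain V :: "(real^3) set" where V: "finite V" "card V = n" "V \<subseteq> sphere 0 1"
    "2 * n - 2 \<le> num_strict_double_normals V"
    using exists_sharp_configuration by blast
  moreover have "num_strict_double_normals V \<le> 2 * n - 2"
    using num_strict_double_normals_le[of V 1 0] V \<open>4 \<le> n\<close> by simp
  ultimately show "\<exists>(V :: (real ^ 3) set) c r. finite V \<and> card V = n \<and> r > 0 \<and>
      V \<subseteq> sphere c r \<and> num_strict_double_normals V = 2 * n - 2"
    by (intro exI[of _ V] exI[of _ 0] exI[of _ 1]) simp
qed (use num_strict_double_normals_le in blast)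

end
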